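(* Let $B=\{100\}$, and let $A(x,v)$ and $B(x,v,u)$ be the generating functions defined in the context. The generating function $\sum_{n\geq 0}|I_n(100)|\,x^{n+1}$ is equal to $A(x,0)$, and it satisfies $$A(x,0)=\frac{x}{1-x}+x\,B(x,x,1).$$
   Context: For $n\ge 0$, $I_n$ denotes the set of inversion sequences $e=e_0e_1\cdots e_n$, i.e. integer sequences with $0\le e_i\le i$ for each $0\le i\le n$. An inversion sequence contains a pattern $\tau$ if it has a (not necessarily consecutive) subsequence order isomorphic to $\tau$ (including equalities); otherwise it avoids $\tau$. $I_n(\tau)$ is the set of $e\in I_n$ avoiding $\tau$, and $I_n(B)$ the set of those avoiding all patterns in $B$. $\mathcal T(B)$ is the rooted plane tree with root $0$ whose level-$n$ nodes are the elements of $I_n(B)$ (root at level 0), where the parent of $e_0\cdots e_n$ is $e_0\cdots e_{n-1}$ and siblings are ordered left to right by increasing last letter. For a node $e$, $\mathcal T(B;e)$ is the subtree consisting of $e$ and its descendants. The generating function for the number of nodes in $\mathcal T(B;e)$ is the power series in which a node at distance $\ell\ge 0$ below the root $e$ contributes $x^{\ell+1}$. Here $0^m$ is the word of $m$ zeros and $0^mj$ is $0^m$ followed by the letter $j$. Let $A_m(x)$ (for $m\ge1$) and $B_{m,j}(x)$ (for $1\le j\le m$) be the generating functions for the number of nodes in $\mathcal T(B;0^m)$ and $\mathcal T(B;0^mj)$ respectively, and set $$A(x,v)=\sum_{m\ge1}A_m(x)v^{m-1},\qquad B(x,v,u)=\sum_{m\ge1}\sum_{j=1}^m B_{m,j}(x)\,v^{m-1}u^{m-j}.$$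 *)

theory Defs
  imports
    "HOL-Library.Sublist"
    "HOL-Computational_Algebra.Computational_Algebra"
begin

text \<open>Inversion sequences \<open>e\<^sub>0 e\<^sub>1 \<dots> e\<^sub>n\<close> are lists of length \<open>n + 1\<close>, so that \<open>e ! i\<close> is \<open>e\<^sub>i\<close>.\<close>

definition inversion_seqs :: "nat \<Rightarrow> nat list set" where
  "inversion_seqs n = {e. length e = n + 1 \<and> (\<forall>i\<le>n. e ! i \<le> i)}"

definition order_isomorphic :: "nat list \<Rightarrow> nat list \<Rightarrow> bool" where
  "order_isomorphic s t \<longleftrightarrow> length s = length t \<and>
     (\<forall>i<length s. \<forall>j<length s.
        (s ! i < s ! j \<longleftrightarrow> t ! i < t ! j) \<and> (s ! i = s ! j \<longleftrightarrow> t ! i = t ! j))"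

definition contains_pattern :: "nat list \<Rightarrow> nat list \<Rightarrow> bool" where
  "contains_pattern e t \<longleftrightarrow> (\<exists>s. subseq s e \<and> order_isomorphic s t)"

definition avoiding_seqs :: "nat list set \<Rightarrow> nat \<Rightarrow> nat list set" where
  "avoiding_seqs P n = {e \<in> inversion_seqs n. \<forall>t\<in>P. \<not> contains_pattern e t}"

text \<open>The tree is given by its nodes and its edges, directed from parent to child. Deleting the last
  letter of the root \<open>[0]\<close> gives the empty list, which is not a node. The left-to-right order of
  siblings is not recorded, since only numbers of nodes are used.\<close>

definition tree_nodes :: "nat list set \<Rightarrow> nat list set" where
  "tree_nodes P = (\<Union>n. avoiding_seqs P n)"

definition tree_edges :: "nat list set \<Rightarrow> (nat list \<times> nat list) set" where
  "tree_edges P = {(e, f). e \<in> tree_nodes P \<and> f \<in> tree_nodes P \<and> e = butlast f}"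

definition descendants_at :: "nat list set \<Rightarrow> nat list \<Rightarrow> nat \<Rightarrow> nat list set" where
  "descendants_at P e l = {f. (e, f) \<in> tree_edges P ^^ l}"

text \<open>Coefficients are rational, rather than integral, so that \<open>x / (1 - x)\<close> is a library quotient.\<close>

definition subtree_gf :: "nat list set \<Rightarrow> nat list \<Rightarrow> rat fps" where
  "subtree_gf P e = fps_X * Abs_fps (\<lambda>l. of_nat (card (descendants_at P e l)))"

definition A_coeff :: "nat list set \<Rightarrow> nat \<Rightarrow> rat fps" where
  "A_coeff P m = subtree_gf P (replicate m 0)"

definition B_coeff :: "nat list set \<Rightarrow> nat \<Rightarrow> nat \<Rightarrow> rat fps" where
  "B_coeff P m j = subtree_gf P (replicate m 0 @ [j])"

text \<open>\<open>A(x, v)\<close> is a power series in \<open>v\<close> over the power series in \<open>x\<close>. In \<open>B(x, v, u)\<close> the coefficient of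
  each power of \<open>v\<close> is a polynomial in \<open>u\<close> over the power series in \<open>x\<close>, which is what allows
  \<open>u = 1\<close>. In both, the coefficient of \<open>v\<^sup>k\<close> belongs to \<open>m = k + 1\<close>.\<close>

definition A_gf :: "nat list set \<Rightarrow> rat fps fps" where
  "A_gf P = Abs_fps (\<lambda>k. A_coeff P (k + 1))"

definition B_gf :: "nat list set \<Rightarrow> rat fps poly fps" where
  "B_gf P = Abs_fps (\<lambda>k. \<Sum>j=1..k+1. monom (B_coeff P (k + 1) j) (k + 1 - j))"

text \<open>Substitution for \<open>v\<close>; the sum is taken in the topology of formal power series in \<open>x\<close> and
  converges whenever \<open>s\<close> has no constant term.\<close>

definition subst_v :: "'a::comm_ring_1 fps fps \<Rightarrow> 'a fps \<Rightarrow> 'a fps" where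
  "subst_v F s = (\<Sum>k. fps_nth F k * s ^ k)"

definition subst_u :: "'a::comm_ring_1 fps poly fps \<Rightarrow> 'a fps \<Rightarrow> 'a fps fps" where
  "subst_u F s = Abs_fps (\<lambda>k. poly (fps_nth F k) s)"

lemma subst_v_sums:
  fixes F :: "'a::comm_ring_1 fps fps"
  assumes "fps_nth s 0 = 0"
  shows "(\<lambda>k. fps_nth F k * s ^ k) sums subst_v F s"
proof -
  have vanish: "fps_nth (fps_nth F k * s ^ k) n = 0" if "n < k" for n k
    unfolding fps_mult_nth
    by (rule sum.neutral)
      (use assms that startsby_zero_power_prefix[of s] in \<open>auto simp: fps_eq_iff\<close>)
  define L where "L = Abs_fps (\<lambda>n. \<Sum>k\<le>n. fps_nth (fps_nth F k * s ^ k) n)"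
  have "(\<lambda>k. fps_nth F k * s ^ k) sums L"
    unfolding sums_def
  proof (rule tendsto_fpsI)
    fix n
    show "eventually (\<lambda>N. fps_nth (\<Sum>k<N. fps_nth F k * s ^ k) n = fps_nth L n) sequentially"
    proof (rule eventually_sequentiallyI[of "Suc n"])
      fix N assume "Suc n \<le> N"
      then have "(\<Sum>k<N. fps_nth (fps_nth F k * s ^ k) n)
          = (\<Sum>k\<le>n. fps_nth (fps_nth F k * s ^ k) n)"
        by (intro sum.mono_neutral_right) (auto intro: vanish)
      then show "fps_nth (\<Sum>k<N. fps_nth F k * s ^ k) n = fps_nth L n"
        by (simp add: L_def fps_sum_nth)
    qed
  qed
  then show ?thesis
    unfolding subst_v_def by (simp add: sums_iff)
qed

end

theory Submission
  imports Defs
begin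

text \<open>
  Avoidance passes to prefixes, so the descendants of a node \<open>e\<close> at distance \<open>l\<close> are exactly the
  avoiding sequences that extend \<open>e\<close> by \<open>l\<close> letters (\<open>descendants_at_eq\<close>). Every inversion sequence
  starts with \<open>0\<close>, so the subtree at the root \<open>0\<close> is the whole tree; since \<open>A(x, 0) = A\<^sub>1(x)\<close>, this is
  the first equation.

  For the second equation, every avoiding sequence \<open>e\<^sub>0 \<dots> e\<^sub>n\<close> either is the word \<open>0\<^sup>n\<^sup>+\<^sup>1\<close> or has exactly
  one prefix \<open>0\<^sup>mj\<close> with \<open>j \<ge> 1\<close>, where \<open>1 \<le> j \<le> m \<le> n\<close>. The zero words contribute \<open>x / (1 - x)\<close>.
  The root of the subtree at \<open>0\<^sup>mj\<close> is a sequence of length \<open>m + 1\<close>, so that subtree contributes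
  \<open>x\<^sup>m B\<^sub>m\<^sub>,\<^sub>j(x)\<close>, and the sum of these over all \<open>m\<close> and \<open>j\<close> is \<open>x B(x, x, 1)\<close>.

  About the pattern \<open>100\<close>, the argument uses only that the words \<open>0\<^sup>mj\<close> with \<open>j \<le> m\<close> are nodes of the
  tree; they are, being weakly increasing.
\<close>

section \<open>Descendants are extensions\<close>

lemma finite_inversion_seqs: "finite (inversion_seqs n)"
proof (rule finite_subset)
  show "inversion_seqs n \<subseteq> {e. set e \<subseteq> {..n} \<and> length e = n + 1}"
    by (auto simp: inversion_seqs_def in_set_conv_nth less_Suc_eq_le) (meson order_trans)
qed (simp add: finite_lists_length_eq)

lemma finite_avoiding_seqs: "finite (avoiding_seqs P n)"
  by (rule finite_subset[OF _ finite_inversion_seqs]) (auto simp: avoiding_seqs_def)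

lemma avoiding_seqs_iff: "f \<in> avoiding_seqs P n \<longleftrightarrow> f \<in> tree_nodes P \<and> length f = n + 1"
  by (auto simp: tree_nodes_def avoiding_seqs_def inversion_seqs_def)

lemma tree_nodes_nth_le:
  assumes "f \<in> tree_nodes P" "i < length f"
  shows "f ! i \<le> i"
  using assms by (auto simp: tree_nodes_def avoiding_seqs_def inversion_seqs_def)

lemma tree_nodes_not_Nil: "f \<in> tree_nodes P \<Longrightarrow> f \<noteq> []"
  by (auto simp: tree_nodes_def avoiding_seqs_def inversion_seqs_def)

lemma contains_pattern_butlast:
  assumes "contains_pattern (butlast f) t"
  shows "contains_pattern f t"
proof -
  have "subseq (butlast f) f"
    by (simp add: prefix_imp_subseq prefixeq_butlast)
  with assms show ?thesis
    unfolding contains_pattern_def by (meson subseq_order.trans)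
qed

lemma butlast_in_tree_nodes:
  assumes "f \<in> tree_nodes P" "length f \<ge> 2"
  shows "butlast f \<in> tree_nodes P"
proof -
  obtain n where n: "f \<in> avoiding_seqs P n" using assms by (auto simp: tree_nodes_def)
  then have "butlast f \<in> avoiding_seqs P (n - 1)"
    using assms(2)
    by (auto simp: avoiding_seqs_def inversion_seqs_def nth_butlast dest: contains_pattern_butlast)
  then show ?thesis by (auto simp: tree_nodes_def)
qed

text \<open>The hypothesis cannot be dropped: at distance \<open>0\<close> the only descendant is \<open>e\<close>, node or not.\<close>

lemma descendants_at_eq:
  assumes "e \<in> tree_nodes P"
  shows "descendants_at P e l =
    {f \<in> tree_nodes P. length f = length e + l \<and> take (length e) f = e}"
proof (induction l)
  case 0
  show ?case using assms by (auto simp: descendants_at_def)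
next
  case (Suc l)
  have "f \<in> descendants_at P e (Suc l) \<longleftrightarrow>
      (\<exists>g \<in> descendants_at P e l. (g, f) \<in> tree_edges P)" for f
    by (auto simp: descendants_at_def)
  moreover have "descendants_at P e l \<subseteq> tree_nodes P"
    using Suc.IH by auto
  ultimately have "f \<in> descendants_at P e (Suc l) \<longleftrightarrow>
      f \<in> tree_nodes P \<and> butlast f \<in> descendants_at P e l" for f
    by (auto simp: tree_edges_def)
  moreover have "butlast f \<in> descendants_at P e l \<longleftrightarrow>
      length f = length e + Suc l \<and> take (length e) f = e" if f: "f \<in> tree_nodes P" for f
  proof -
    have "length e > 0" "length f > 0"
      using assms f by (auto dest: tree_nodes_not_Nil)
    then show ?thesis
      using butlast_in_tree_nodes[OF f] unfolding Suc.IH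
      by (auto simp: butlast_conv_take take_take min_def Suc_le_eq)
  qed
  ultimately show ?case by blast
qed

lemma descendants_at_root:
  assumes "[0] \<in> tree_nodes P"
  shows "descendants_at P [0] n = avoiding_seqs P n"
proof -
  have "take 1 f = [0]" if "f \<in> tree_nodes P" for f
    using tree_nodes_nth_le[OF that, of 0] tree_nodes_not_Nil[OF that] by (cases f) auto
  then show ?thesis
    by (auto simp: descendants_at_eq[OF assms] avoiding_seqs_iff)
qed

section \<open>Splitting at the first nonzero letter\<close>

text \<open>Here \<open>m\<close> is the position of the letter \<open>j\<close>; if \<open>j \<noteq> 0\<close>, it is that of the first nonzero letter.\<close>

lemma take_Suc_eq_zeros_iff:
  assumes "m < length f"
  shows "take (Suc m) f = replicate m 0 @ [j] \<longleftrightarrow> (\<forall>i<m. f ! i = 0) \<and> f ! m = j"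
  using assms by (auto simp: list_eq_iff_nth_eq nth_append less_Suc_eq)

lemma zeros_in_tree_nodes:
  assumes "\<And>m j. j \<le> m \<Longrightarrow> replicate m 0 @ [j] \<in> tree_nodes P"
  shows "replicate (Suc n) 0 \<in> tree_nodes P"
  using assms[of 0 n] by (simp add: replicate_append_same)

text \<open>The number \<open>m\<close> of initial zeros is written \<open>k + 1\<close>, where \<open>k\<close> is the exponent of \<open>v\<close> belonging to
  \<open>m\<close> in \<open>B(x, v, u)\<close>. The words \<open>0\<^sup>mj\<close> are required to be nodes also for \<open>j = 0\<close> or \<open>m = 0\<close>, which
  makes all the nonempty zero words nodes.\<close>

lemma avoiding_seqs_decomp:
  assumes nodes: "\<And>m j. j \<le> m \<Longrightarrow> replicate m 0 @ [j] \<in> tree_nodes P"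
  shows "avoiding_seqs P n = insert (replicate (Suc n) 0)
    (\<Union>(k, j) \<in> (SIGMA k:{..<n}. {1..k+1}).
      descendants_at P (replicate (k+1) 0 @ [j]) (n - (k+1)))"
    (is "_ = insert ?z ?U")
proof (intro equalityI subsetI)
  fix f assume f: "f \<in> avoiding_seqs P n"
  then have node: "f \<in> tree_nodes P" and len: "length f = n + 1"
    by (auto simp: avoiding_seqs_iff)
  show "f \<in> insert ?z ?U"
  proof (cases "\<forall>i<length f. f ! i = 0")
    case True
    then have "f = ?z" using len by (auto simp: list_eq_iff_nth_eq simp del: replicate_Suc)
    then show ?thesis by simp
  next
    case False
    define m where "m = (LEAST i. i < length f \<and> f ! i \<noteq> 0)"
    have m: "m < length f" "f ! m \<noteq> 0"
      using False LeastI_ex[of "\<lambda>i. i < length f \<and> f ! i \<noteq> 0"] by (auto simp: m_def)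
    have zeros: "\<forall>i<m. f ! i = 0"
    proof (intro allI impI)
      fix i assume i: "i < m"
      then have "\<not> (i < length f \<and> f ! i \<noteq> 0)" unfolding m_def by (rule not_less_Least)
      then show "f ! i = 0" using i m(1) by simp
    qed
    have le: "f ! m \<le> m" using tree_nodes_nth_le[OF node m(1)] .
    \<comment> \<open>\<open>m\<close> is positive because \<open>f ! 0 \<le> 0\<close>.\<close>
    obtain k where k: "m = Suc k" using le m(2) by (cases m) auto
    have "f \<in> descendants_at P (replicate m 0 @ [f ! m]) (n - m)"
      using node len m zeros take_Suc_eq_zeros_iff[OF m(1), of "f ! m"]
      by (simp add: descendants_at_eq[OF nodes[OF le]])
    then show ?thesis
      using k m le len by (intro insertI2 UN_I[of "(k, f ! m)"]) auto
  qed
next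
  fix f assume "f \<in> insert ?z ?U"
  then consider "f = ?z" | k j where "k < n" "1 \<le> j" "j \<le> k + 1"
    "f \<in> descendants_at P (replicate (k+1) 0 @ [j]) (n - (k+1))" by auto
  then show "f \<in> avoiding_seqs P n"
  proof cases
    case 1
    then show ?thesis using zeros_in_tree_nodes[OF nodes, of n] by (simp add: avoiding_seqs_iff)
  next
    case 2
    then show ?thesis by (simp add: descendants_at_eq[OF nodes] avoiding_seqs_iff del: replicate_Suc)
  qed
qed

lemma card_avoiding_seqs:
  assumes nodes: "\<And>m j. j \<le> m \<Longrightarrow> replicate m 0 @ [j] \<in> tree_nodes P"
  shows "card (avoiding_seqs P n) = 1 + (\<Sum>k<n. \<Sum>j=1..k+1.
    card (descendants_at P (replicate (k+1) 0 @ [j]) (n - (k+1))))"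
proof -
  define I where "I = (SIGMA k:{..<n}. {1..k+1})"
  define D where "D = (\<lambda>(k, j). descendants_at P (replicate (k+1) 0 @ [j]) (n - (k+1)))"
  have decomp: "avoiding_seqs P n = insert (replicate (Suc n) 0) (\<Union>p\<in>I. D p)"
    using avoiding_seqs_decomp[OF nodes, of n] by (simp add: I_def D_def split_def)
  have D: "(\<forall>i<k+1. f ! i = 0) \<and> f ! (k+1) = j \<and> length f = n + 1"
    if "(k, j) \<in> I" "f \<in> D (k, j)" for f k j
  proof -
    have "j \<le> k + 1" "k < n" using that by (auto simp: I_def)
    with that(2) have "length f = n + 1" "take (Suc (k+1)) f = replicate (k+1) 0 @ [j]"
      by (auto simp: D_def descendants_at_eq[OF nodes] simp del: replicate_Suc)
    then show ?thesis using take_Suc_eq_zeros_iff[of "k+1" f j] \<open>k < n\<close> by simp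
  qed
  have fin: "finite I" by (simp add: I_def)
  have finD: "finite (D p)" if "p \<in> I" for p
    using that decomp by (intro finite_subset[OF _ finite_avoiding_seqs[of P n]]) auto
  have disj: "D p \<inter> D q = {}" if pq: "p \<in> I" "q \<in> I" "p \<noteq> q" for p q
  proof (rule ccontr)
    assume "D p \<inter> D q \<noteq> {}"
    then obtain f where f: "f \<in> D p" "f \<in> D q" by auto
    obtain k j k' j' where p: "p = (k, j)" "q = (k', j')" by (cases p, cases q)
    have ge: "j \<ge> 1" "j' \<ge> 1" using pq p by (auto simp: I_def)
    have 1: "(\<forall>i<k+1. f ! i = 0) \<and> f ! (k+1) = j" using D[of k j f] pq f p by blast
    have 2: "(\<forall>i<k'+1. f ! i = 0) \<and> f ! (k'+1) = j'" using D[of k' j' f] pq f p by blast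
    from 1 2 ge have "\<not> k < k'" "\<not> k' < k" by fastforce+
    with 1 2 p pq(3) show False by auto
  qed
  have notin: "replicate (Suc n) 0 \<notin> (\<Union>p\<in>I. D p)"
  proof
    assume "replicate (Suc n) 0 \<in> (\<Union>p\<in>I. D p)"
    then obtain k j where kj: "(k, j) \<in> I" "replicate (Suc n) 0 \<in> D (k, j)" by auto
    then have "replicate (Suc n) 0 ! (k+1) = j" "k < n" "j \<ge> 1"
      using D[OF kj] by (auto simp: I_def simp del: replicate_Suc)
    then show False by (simp del: replicate_Suc)
  qed
  have "card (\<Union>p\<in>I. D p) = (\<Sum>p\<in>I. card (D p))"
    using fin finD disj by (intro card_UN_disjoint) auto
  also have "\<dots> = (\<Sum>k<n. \<Sum>j=1..k+1. card (D (k, j)))"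
    unfolding I_def by (subst sum.Sigma) (simp_all add: split_def)
  finally show ?thesis
    using fin finD notin by (simp add: decomp D_def del: replicate_Suc)
qed

section \<open>Generating functions\<close>

lemma subst_v_zero: "subst_v F 0 = fps_nth F 0"
proof -
  have "(\<lambda>k. fps_nth F k * 0 ^ k) sums (\<Sum>k\<in>{0}. fps_nth F k * 0 ^ k)"
    by (rule sums_finite) (auto simp: power_0_left)
  moreover have "(\<lambda>k. fps_nth F k * 0 ^ k) sums subst_v F 0"
    by (rule subst_v_sums) simp
  ultimately show ?thesis using sums_unique2 by fastforce
qed

lemma fps_nth_subst_v_fps_X:
  "fps_nth (subst_v F fps_X) n = (\<Sum>k\<le>n. fps_nth (fps_nth F k) (n - k))"
proof -
  define L where "L = Abs_fps (\<lambda>n. \<Sum>k\<le>n. fps_nth (fps_nth F k) (n - k))"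
  have "(\<lambda>k. fps_nth F k * fps_X ^ k) sums L"
    unfolding sums_def
  proof (rule tendsto_fpsI)
    fix n
    show "eventually (\<lambda>N. fps_nth (\<Sum>k<N. fps_nth F k * fps_X ^ k) n = fps_nth L n) sequentially"
    proof (rule eventually_sequentiallyI[of "Suc n"])
      fix N assume "Suc n \<le> N"
      then have "(\<Sum>k<N. fps_nth (fps_nth F k * fps_X ^ k) n)
          = (\<Sum>k\<le>n. fps_nth (fps_nth F k * fps_X ^ k) n)"
        by (intro sum.mono_neutral_right) (auto simp: fps_X_power_mult_right_nth)
      then show "fps_nth (\<Sum>k<N. fps_nth F k * fps_X ^ k) n = fps_nth L n"
        by (simp add: L_def fps_sum_nth fps_X_power_mult_right_nth)
    qed
  qed
  moreover have "(\<lambda>k. fps_nth F k * fps_X ^ k) sums subst_v F fps_X"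
    by (rule subst_v_sums) simp
  ultimately have "subst_v F fps_X = L" by (rule sums_unique2[rotated])
  then show ?thesis by (simp add: L_def)
qed

lemma fps_nth_subst_u_B_gf:
  "fps_nth (subst_u (B_gf P) 1) k = (\<Sum>j=1..k+1. B_coeff P (k+1) j)"
  by (simp add: subst_u_def B_gf_def poly_sum poly_monom)

lemma subst_v_A_gf_zero:
  assumes "[0] \<in> tree_nodes P"
  shows "subst_v (A_gf P) 0 = fps_X * Abs_fps (\<lambda>n. of_nat (card (avoiding_seqs P n)))"
  by (simp add: subst_v_zero A_gf_def A_coeff_def subtree_gf_def descendants_at_root[OF assms])

lemma fps_nth_subst_v_B_gf:
  "fps_nth (subst_v (subst_u (B_gf P) 1) fps_X) n = (\<Sum>k<n. \<Sum>j=1..k+1.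
    of_nat (card (descendants_at P (replicate (k+1) 0 @ [j]) (n - (k+1)))))"
proof -
  have "fps_nth (subst_v (subst_u (B_gf P) 1) fps_X) n =
      (\<Sum>k\<le>n. \<Sum>j=1..k+1. fps_nth (B_coeff P (k+1) j) (n - k))"
    by (simp add: fps_nth_subst_v_fps_X fps_nth_subst_u_B_gf fps_sum_nth)
  also have "\<dots> = (\<Sum>k<n. \<Sum>j=1..k+1. fps_nth (B_coeff P (k+1) j) (n - k))"
    \<comment> \<open>The series \<open>B\<^sub>m\<^sub>,\<^sub>j(x)\<close> have no constant term, so the summand for \<open>k = n\<close> vanishes.\<close>
    by (rule sum.mono_neutral_right) (auto simp: B_coeff_def subtree_gf_def)
  also have "\<dots> = (\<Sum>k<n. \<Sum>j=1..k+1.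
      of_nat (card (descendants_at P (replicate (k+1) 0 @ [j]) (n - (k+1)))))"
    by (intro sum.cong refl) (auto simp: B_coeff_def subtree_gf_def)
  finally show ?thesis .
qed

lemma fps_X_divide_one_minus_fps_X:
  "fps_X / (1 - fps_X) = fps_X * Abs_fps (\<lambda>_. 1 :: 'a :: field)"
proof -
  have "inverse (1 - fps_X :: 'a fps) = Abs_fps (\<lambda>_. 1)"
    by (rule fps_inverse_one_minus_fps_X)
  then show ?thesis by (simp add: fps_divide_unit)
qed

lemma subst_v_A_gf_zero_eq:
  assumes nodes: "\<And>m j. j \<le> m \<Longrightarrow> replicate m 0 @ [j] \<in> tree_nodes P"
  shows "subst_v (A_gf P) 0 =
    fps_X / (1 - fps_X) + fps_X * subst_v (subst_u (B_gf P) 1) fps_X"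
proof -
  have "Abs_fps (\<lambda>n. of_nat (card (avoiding_seqs P n))) =
      Abs_fps (\<lambda>_. 1) + subst_v (subst_u (B_gf P) 1) fps_X"
    by (rule fps_ext) (simp only: fps_add_nth fps_nth_Abs_fps card_avoiding_seqs[OF nodes]
      fps_nth_subst_v_B_gf of_nat_add of_nat_1 of_nat_sum)
  moreover have "[0] \<in> tree_nodes P" using nodes[of 0 0] by simp
  ultimately show ?thesis
    by (simp add: subst_v_A_gf_zero fps_X_divide_one_minus_fps_X distrib_left)
qed

section \<open>The pattern 100\<close>

lemma sorted_avoids_100:
  assumes "sorted e"
  shows "\<not> contains_pattern e [1, 0, 0]"
proof
  assume "contains_pattern e [1, 0, 0]"
  then obtain s where s: "subseq s e" "order_isomorphic s [1, 0, 0]"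
    by (auto simp: contains_pattern_def)
  have len: "length s = 3" using s(2) by (simp add: order_isomorphic_def)
  \<comment> \<open>The initial descent of \<open>100\<close> already contradicts sortedness.\<close>
  have "s ! 1 < s ! 0 \<longleftrightarrow> [1, 0, 0 :: nat] ! 1 < [1, 0, 0] ! 0"
    using s(2) len unfolding order_isomorphic_def by auto
  moreover have "sorted s"
    using s(1) assms by (metis sorted_nths subseq_conv_nths)
  ultimately show False using len sorted_nth_mono[of s 0 1] by simp
qed

lemma zeros_append_in_tree_nodes_100:
  assumes "j \<le> m"
  shows "replicate m 0 @ [j] \<in> tree_nodes {[1, 0, 0]}"
proof -
  have "replicate m 0 @ [j] \<in> inversion_seqs m"
    using assms by (auto simp: inversion_seqs_def nth_append)
  moreover have "sorted (replicate m 0 @ [j])"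
    by (simp add: sorted_append)
  ultimately show ?thesis
    using sorted_avoids_100 by (auto simp: tree_nodes_def avoiding_seqs_def)
qed

theorem theorem3p2:
  shows "fps_X * Abs_fps (\<lambda>n. of_nat (card (avoiding_seqs {[1, 0, 0]} n))) =
           subst_v (A_gf {[1, 0, 0]}) 0 \<and>
         subst_v (A_gf {[1, 0, 0]}) 0 =
           fps_X / (1 - fps_X) + fps_X * subst_v (subst_u (B_gf {[1, 0, 0]}) 1) fps_X"
  using subst_v_A_gf_zero[of "{[1, 0, 0]}"] zeros_append_in_tree_nodes_100[of 0 0]
    subst_v_A_gf_zero_eq[OF zeros_append_in_tree_nodes_100]
  by simp

end
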